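(* Let $S$ be a ring, $R$ a subring of $S$, and $I$ an ideal of $S$ such that $S/I$ is a Noetherian ring and $R/(I\cap R)$ is a principal ideal ring. Then $I$ is an $R$-conductor ideal of $S$ if and only if for every $M\in\mathcal{V}(I)$ we have $R+M\subsetneqq S$ or $(I:_R M)\subseteq I$.
   Context: All rings are commutative with an identity element, and every subring of a ring contains the identity of the extension ring. A principal ideal ring is a ring (not necessarily a domain) in which every ideal is principal. For subsets $X,Y,Z\subseteq S$ set $(X:_Y Z)=\{x\in Y\mid xZ\subseteq X\}$. An ideal $I$ of $S$ is called an $R$-conductor ideal of $S$ if $I=(V:_S S)$ for some intermediate ring $R\subseteq V\subseteq S$. For an ideal $I$ of $S$ set $\mathcal{V}(I)=\{M\in\mathrm{spec}(S)\mid I\subseteq M\}$, the set of prime ideals of $S$ containing $I$. *)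

theory Defs
  imports "HOL-Algebra.Ring_Divisibility" "HOL-Algebra.Subrings"
begin

text \<open>
  Subrings of \<open>S\<close> are subsets \<open>R \<subseteq> carrier S\<close> with \<^term>\<open>subring R S\<close>, which includes
  \<open>\<one>\<^bsub>S\<^esub> \<in> R\<close>; as a ring in its own right, \<open>R\<close> is \<open>S\<lparr>carrier := R\<rparr>\<close>.
  The zero ring is allowed, as in \<^locale>\<open>cring\<close>.
\<close>

locale principal_ideal_ring = cring +
  assumes ideal_is_principal: "ideal I R \<Longrightarrow> principalideal I R"

text \<open>\<open>colon S X Y Z\<close> is $(X :_Y Z)$, with the product taken in \<open>S\<close>.\<close>

definition colon :: "('a, 'b) ring_scheme \<Rightarrow> 'a set \<Rightarrow> 'a set \<Rightarrow> 'a set \<Rightarrow> 'a set"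
  where "colon S X Y Z = {x \<in> Y. \<forall>z\<in>Z. x \<otimes>\<^bsub>S\<^esub> z \<in> X}"

definition conductor_ideal :: "('a, 'b) ring_scheme \<Rightarrow> 'a set \<Rightarrow> 'a set \<Rightarrow> bool"
  where "conductor_ideal S R I \<longleftrightarrow> ideal I S \<and>
    (\<exists>V. subring V S \<and> R \<subseteq> V \<and> I = colon S V (carrier S) (carrier S))"

definition prime_ideals_above :: "('a, 'b) ring_scheme \<Rightarrow> 'a set \<Rightarrow> 'a set set"
  where "prime_ideals_above S I = {M. primeideal M S \<and> I \<subseteq> M}"

end

theory Submission
  imports Defs
begin

text \<open>
  The largest ideal \<open>C\<close> of \<open>S\<close> inside \<open>R + I\<close> is the conductor of \<open>R + I\<close>, and \<open>I\<close> is an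
  \<open>R\<close>-conductor ideal iff \<open>C \<subseteq> I\<close>. If \<open>C\<close> is larger than \<open>I\<close>, write \<open>C \<inter> R = aR + (I \<inter> R)\<close>, so that
  \<open>aS \<subseteq> aR + I\<close>, i.e. \<open>S = R + (I : a)\<close>. As \<open>S/I\<close> is Noetherian, some \<open>M = (I : ab)\<close> with \<open>ab \<notin> I\<close> is
  prime; then \<open>R + M = S\<close>, and \<open>ab\<close> is congruent modulo \<open>I\<close> to an element of \<open>(I :\<^sub>R M)\<close> outside \<open>I\<close>.
  Conversely, if \<open>R + M = S\<close> and \<open>x \<in> R\<close> satisfies \<open>xM \<subseteq> I\<close>, then \<open>xS \<subseteq> R + I\<close>.
\<close>

section \<open>Maximal members of families of ideals\<close>

lemma (in noetherian_ring) exists_maximal_ideal: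
  assumes "F \<noteq> {}" and "F \<subseteq> {J. ideal J R}"
  shows "\<exists>M\<in>F. \<forall>J\<in>F. M \<subseteq> J \<longrightarrow> J = M"
proof (rule subset_Zorn_nonempty[OF assms(1)])
  \<comment> \<open>The union of a nonempty chain of ideals of a Noetherian ring is a member of the
    chain, hence an upper bound in \<open>F\<close>.\<close>
  fix C assume C: "C \<noteq> {}" "subset.chain F C"
  then have "subset.chain {J. ideal J R} C"
    using assms(2) by (auto simp: subset_chain_def)
  with C show "\<Union>C \<in> F"
    using ideal_chain_is_trivial by (auto simp: subset_chain_def)
qed

text \<open>Only the quotient is Noetherian, so a maximal member is found among the images in
  \<open>R Quot I\<close> and pulled back: taking images is injective on the ideals above
  \<open>I\<close>.\<close>

lemma (in ring) exists_maximal_ideal_above: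
  assumes I: "ideal I R" and "noetherian_ring (R Quot I)"
    and "F \<noteq> {}" and F: "\<And>J. J \<in> F \<Longrightarrow> ideal J R \<and> I \<subseteq> J"
  shows "\<exists>M\<in>F. \<forall>J\<in>F. M \<subseteq> J \<longrightarrow> J = M"
proof -
  let ?q = "\<lambda>J. (+>) I ` J"
  have "\<exists>N\<in>?q ` F. \<forall>J\<in>?q ` F. N \<subseteq> J \<longrightarrow> J = N"
    using assms by (intro noetherian_ring.exists_maximal_ideal) (auto intro: ring_ideal_imp_quot_ideal)
  then have "\<exists>M\<in>F. \<forall>J\<in>F. ?q M \<subseteq> ?q J \<longrightarrow> ?q J = ?q M"
    by (simp only: bex_simps ball_simps)
  then obtain M where M: "M \<in> F" and max: "\<forall>J\<in>F. ?q M \<subseteq> ?q J \<longrightarrow> ?q J = ?q M" ..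
  have inj: "inj_on ?q {J. ideal J R \<and> I \<subseteq> J}"
    using quot_ideal_correspondence[OF I] by (rule bij_betw_imp_inj_on)
  have "J = M" if "J \<in> F" "M \<subseteq> J" for J
  proof -
    have "?q J = ?q M"
      using bspec[OF max that(1)] image_mono[OF that(2)] by (rule mp)
    then show ?thesis
      by (rule inj_onD[OF inj]) (use F M that(1) in auto)
  qed
  with M show ?thesis by blast
qed

section \<open>Colon ideals, prime colons, and principal ideals modulo an ideal\<close>

lemma (in ring) subgroup_colon:
  assumes "additive_subgroup H R" and "X \<subseteq> carrier R"
  shows "subgroup (colon R H (carrier R) X) (add_monoid R)"
proof -
  interpret H: additive_subgroup H R by fact
  have X: "x \<in> carrier R" if "x \<in> X" for x
    using assms(2) that by blast
  show ?thesis
  proof (rule add.subgroupI)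
    have "\<zero> \<in> colon R H (carrier R) X"
      by (simp add: colon_def X)
    then show "colon R H (carrier R) X \<noteq> {}" by blast
  qed (auto simp: colon_def X l_distr l_minus)
qed

lemma (in cring) colon_subset_is_ideal:
  assumes "ideal I R" and "X \<subseteq> carrier R"
  shows "ideal (colon R I (carrier R) X) R"
proof -
  interpret I: ideal I R by fact
  have X: "x \<in> carrier R" if "x \<in> X" for x
    using assms(2) that by blast
  show ?thesis
  proof (rule idealI)
    show "ring R" by (rule ring_axioms)
    show "subgroup (colon R I (carrier R) X) (add_monoid R)"
      using I.is_additive_subgroup assms(2) by (rule subgroup_colon)
  next
    fix a x assume "a \<in> colon R I (carrier R) X" "x \<in> carrier R"
    then show "x \<otimes> a \<in> colon R I (carrier R) X"
      by (auto simp: colon_def X m_assoc I.I_l_closed)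
    then show "a \<otimes> x \<in> colon R I (carrier R) X"
      using \<open>a \<in> _\<close> \<open>x \<in> _\<close> by (simp add: colon_def m_comm)
  qed
qed

text \<open>This is the existence of associated primes: among the annihilators of the nonzero
  multiples of the class of \<open>a\<close> modulo \<open>I\<close>, a maximal one is
  prime.\<close>

lemma (in cring) exists_prime_colon:
  assumes I: "ideal I R" and "noetherian_ring (R Quot I)"
    and a: "a \<in> carrier R" "a \<notin> I"
  shows "\<exists>b\<in>carrier R. a \<otimes> b \<notin> I \<and> primeideal (colon R I (carrier R) {a \<otimes> b}) R"
proof -
  interpret I: ideal I R by fact
  let ?c = "\<lambda>x. colon R I (carrier R) {x}"
  let ?B = "{b \<in> carrier R. a \<otimes> b \<notin> I}"
  have "\<exists>M\<in>(\<lambda>b. ?c (a \<otimes> b)) ` ?B. \<forall>J\<in>(\<lambda>b. ?c (a \<otimes> b)) ` ?B. M \<subseteq> J \<longrightarrow> J = M"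
  proof (rule exists_maximal_ideal_above[OF I assms(2)])
    have "\<one> \<in> ?B" using a by simp
    then show "(\<lambda>b. ?c (a \<otimes> b)) ` ?B \<noteq> {}" by blast
  next
    fix J assume "J \<in> (\<lambda>b. ?c (a \<otimes> b)) ` ?B"
    then show "ideal J R \<and> I \<subseteq> J"
      using I a by (auto intro!: colon_subset_is_ideal) (auto simp: colon_def I.I_r_closed)
  qed
  then obtain b where b: "b \<in> carrier R" "a \<otimes> b \<notin> I"
    and max: "\<And>d. d \<in> ?B \<Longrightarrow> ?c (a \<otimes> b) \<subseteq> ?c (a \<otimes> d) \<Longrightarrow> ?c (a \<otimes> d) = ?c (a \<otimes> b)"
    by blast
  have "primeideal (?c (a \<otimes> b)) R"
  proof (rule primeidealI)
    show "ideal (?c (a \<otimes> b)) R"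
      using a b by (intro colon_subset_is_ideal I) simp
    show "cring R" by (rule cring_axioms)
    show "carrier R \<noteq> ?c (a \<otimes> b)"
    proof
      assume "carrier R = ?c (a \<otimes> b)"
      then have "\<one> \<in> ?c (a \<otimes> b)" using one_closed by blast
      then show False using a b by (simp add: colon_def)
    qed
  next
    fix u v
    assume uv: "u \<in> carrier R" "v \<in> carrier R" "u \<otimes> v \<in> ?c (a \<otimes> b)"
    show "u \<in> ?c (a \<otimes> b) \<or> v \<in> ?c (a \<otimes> b)"
    proof (rule disjCI)
      \<comment> \<open>Since \<open>abv\<close> is outside \<open>I\<close>, \<open>bv\<close>
        competes with \<open>b\<close>, and maximality turns the inclusion of (I : ab) in (I : abv)
        into equality. The ideal (I : abv) contains \<open>u\<close> because \<open>uvab\<close> is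
        in \<open>I\<close>.\<close>
      assume v: "v \<notin> ?c (a \<otimes> b)"
      have eq: "w \<otimes> (a \<otimes> (b \<otimes> v)) = v \<otimes> (w \<otimes> (a \<otimes> b))"
        "w \<otimes> (a \<otimes> (b \<otimes> v)) = (w \<otimes> v) \<otimes> (a \<otimes> b)" if "w \<in> carrier R" for w
        using that a b uv by (simp_all add: m_ac)
      have "a \<otimes> (b \<otimes> v) = v \<otimes> (a \<otimes> b)"
        using a b uv by (simp add: m_ac)
      then have "b \<otimes> v \<in> ?B"
        using v b uv by (simp add: colon_def)
      moreover have "?c (a \<otimes> b) \<subseteq> ?c (a \<otimes> (b \<otimes> v))"
        using uv by (auto simp: colon_def eq(1) I.I_l_closed)
      ultimately have "?c (a \<otimes> (b \<otimes> v)) = ?c (a \<otimes> b)" by (rule max)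
      moreover have "u \<in> ?c (a \<otimes> (b \<otimes> v))"
        using uv by (simp add: colon_def eq(2))
      ultimately show "u \<in> ?c (a \<otimes> b)" by simp
    qed
  qed
  with b show ?thesis by blast
qed

text \<open>A generator of the image of \<open>J\<close> in the quotient lies in that image, so it
  lifts to some \<open>a\<close> in \<open>J\<close>; it generates \<open>J\<close> up to elements
  of \<open>K\<close>. It will be applied inside the subring, to contracted ideals.\<close>

lemma (in cring) principal_modulo_ideal:
  assumes K: "ideal K R" and pir: "principal_ideal_ring (R Quot K)" and J: "ideal J R"
  shows "\<exists>a\<in>J. \<forall>x\<in>J. \<exists>r\<in>carrier R. \<exists>k\<in>K. x = k \<oplus> r \<otimes> a"
proof -
  interpret K: ideal K R by fact
  interpret Q: principal_ideal_ring "R Quot K" by fact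
  let ?J = "(+>) K ` J"
  have "ideal ?J (R Quot K)"
    using K J by (rule ring_ideal_imp_quot_ideal)
  then have "principalideal ?J (R Quot K)"
    by (rule Q.ideal_is_principal)
  then obtain g where g: "g \<in> carrier (R Quot K)" "?J = PIdl\<^bsub>R Quot K\<^esub> g"
    using principalideal.generate Q.cgenideal_eq_genideal by metis
  then have "g \<in> ?J" using Q.cgenideal_self by simp
  then obtain a where a: "a \<in> J" "g = K +> a" by blast
  have Jc: "x \<in> carrier R" if "x \<in> J" for x
    using J that by (rule ideal.Icarr)
  have "\<exists>r\<in>carrier R. \<exists>k\<in>K. x = k \<oplus> r \<otimes> a" if x: "x \<in> J" for x
  proof -
    have "K +> x \<in> PIdl\<^bsub>R Quot K\<^esub> g"
      using g(2) x by blast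
    then obtain r where r: "r \<in> carrier R" "K +> x = (K +> r) \<otimes>\<^bsub>R Quot K\<^esub> (K +> a)"
      unfolding cgenideal_def a(2) by (auto simp: FactRing_def A_RCOSETS_def')
    then have "K +> x = K +> (r \<otimes> a)"
      using a Jc by (simp add: FactRing_def K.rcoset_mult_add)
    then have "x \<in> K +> (r \<otimes> a)"
      using K.a_rcos_self[OF Jc[OF x]] by simp
    then show ?thesis
      using r(1) by (auto simp: a_r_coset_def')
  qed
  with a show ?thesis by blast
qed

section \<open>Conductors of subrings and the two implications\<close>

lemma mem_set_add_iff:
  "h \<in> A <+>\<^bsub>R\<^esub> B \<longleftrightarrow> (\<exists>a\<in>A. \<exists>b\<in>B. h = a \<oplus>\<^bsub>R\<^esub> b)"
  by (auto simp: set_add_def')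

lemma (in cring) subring_add_ideal:
  assumes A: "subring A R" and I: "ideal I R"
  shows "subring (A <+>\<^bsub>R\<^esub> I) R"
proof -
  interpret I: ideal I R by fact
  note A' = subringE[OF A]
  have Ac: "x \<in> carrier R" if "x \<in> A" for x
    using A'(1) that by blast
  show ?thesis
  proof (rule subringI)
    show "A <+>\<^bsub>R\<^esub> I \<subseteq> carrier R"
      using Ac by (auto simp: mem_set_add_iff)
    have "\<one> = \<one> \<oplus> \<zero>" by simp
    then show "\<one> \<in> A <+>\<^bsub>R\<^esub> I"
      unfolding mem_set_add_iff using A'(3) I.zero_closed by blast
  next
    fix h assume "h \<in> A <+>\<^bsub>R\<^esub> I"
    then obtain x i where h: "x \<in> A" "i \<in> I" "h = x \<oplus> i" by (auto simp: mem_set_add_iff)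
    then have "\<ominus> h = \<ominus> x \<oplus> \<ominus> i" using Ac by (simp add: minus_add)
    then show "\<ominus> h \<in> A <+>\<^bsub>R\<^esub> I"
      unfolding mem_set_add_iff using A'(5) I.a_inv_closed h by blast
  next
    fix h h' assume "h \<in> A <+>\<^bsub>R\<^esub> I" "h' \<in> A <+>\<^bsub>R\<^esub> I"
    then obtain x i x' i' where h: "x \<in> A" "i \<in> I" "h = x \<oplus> i"
      and h': "x' \<in> A" "i' \<in> I" "h' = x' \<oplus> i'" by (auto simp: mem_set_add_iff)
    note c = h(1)[THEN Ac] h'(1)[THEN Ac] h(2)[THEN I.Icarr] h'(2)[THEN I.Icarr]
    \<comment> \<open>The first summand stays in the subring, and the bracket collects the terms
      with a factor in \<open>I\<close>.\<close>
    have "h \<otimes> h' = x \<otimes> x' \<oplus> (x \<otimes> i' \<oplus> i \<otimes> h')"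
      unfolding h(3) h'(3) using c by algebra
    moreover have "x \<otimes> i' \<oplus> i \<otimes> h' \<in> I"
      using h h' c by (simp add: I.I_l_closed I.I_r_closed)
    ultimately show "h \<otimes> h' \<in> A <+>\<^bsub>R\<^esub> I"
      unfolding mem_set_add_iff using A'(6) h h' by blast
    have "h \<oplus> h' = (x \<oplus> x') \<oplus> (i \<oplus> i')"
      unfolding h(3) h'(3) using c by algebra
    then show "h \<oplus> h' \<in> A <+>\<^bsub>R\<^esub> I"
      unfolding mem_set_add_iff using A'(7) I.a_closed h h' by blast
  qed
qed

text \<open>Absorption holds although \<open>V\<close> is only a subring: multiples of
  \<open>ax\<close> are multiples of \<open>a\<close>, so they lie in \<open>V\<close>.\<close>

lemma (in cring) conductor_is_ideal:
  assumes V: "subring V R"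
  shows "ideal (colon R V (carrier R) (carrier R)) R"
proof (rule idealI)
  show "ring R" by (rule ring_axioms)
  \<comment> \<open>\<open>subgroup_colon\<close> asks only for an additive subgroup, so it covers
    \<open>V\<close> as well as ideals.\<close>
  show "subgroup (colon R V (carrier R) (carrier R)) (add_monoid R)"
    using subring.axioms(1)[OF V] by (intro subgroup_colon additive_subgroupI) simp_all
next
  fix a x assume a: "a \<in> colon R V (carrier R) (carrier R)" and x: "x \<in> carrier R"
  then show "a \<otimes> x \<in> colon R V (carrier R) (carrier R)"
    by (simp add: colon_def m_assoc)
  then show "x \<otimes> a \<in> colon R V (carrier R) (carrier R)"
    using a x by (simp add: colon_def m_comm)
qed

text \<open>From here on \<open>R\<close> is the large ring and \<open>A\<close> its subring.
  Writing s = r + m gives xs = xr + xm, where \<open>xr\<close> is in \<open>A\<close> and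
  \<open>xm\<close> in \<open>I\<close>, both inside \<open>V\<close>; thus \<open>x\<close> lies in
  the conductor of \<open>V\<close>.\<close>

lemma (in cring) conductor_ideal_imp_colon_subset:
  assumes "conductor_ideal R A I" and "M \<subseteq> carrier R" and "A <+>\<^bsub>R\<^esub> M = carrier R"
  shows "colon R I A M \<subseteq> I"
proof
  fix x assume x: "x \<in> colon R I A M"
  obtain V where V: "subring V R" "A \<subseteq> V" and I: "I = colon R V (carrier R) (carrier R)"
    using assms(1) by (auto simp: conductor_ideal_def)
  note V' = subringE[OF V(1)]
  \<comment> \<open>A conductor lies in its subring: multiply by the identity.\<close>
  have IV: "I \<subseteq> V"
  proof
    fix i assume "i \<in> I"
    then have "i \<in> carrier R" "i \<otimes> \<one> \<in> V" unfolding I colon_def by blast+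
    then show "i \<in> V" by simp
  qed
  have xA: "x \<in> A" and xM: "\<And>m. m \<in> M \<Longrightarrow> x \<otimes> m \<in> I"
    using x by (auto simp: colon_def)
  have Ac: "A \<subseteq> carrier R" using V(2) V'(1) by blast
  have "x \<otimes> s \<in> V" if "s \<in> carrier R" for s
  proof -
    obtain r m where rm: "r \<in> A" "m \<in> M" "s = r \<oplus> m"
      using \<open>s \<in> carrier R\<close> unfolding assms(3)[symmetric] mem_set_add_iff by blast
    then have "x \<otimes> s = x \<otimes> r \<oplus> x \<otimes> m"
      using Ac xA assms(2) by (simp add: subset_iff r_distr)
    moreover have "x \<otimes> r \<in> V"
      using xA rm(1) V(2) by (blast intro: V'(6))
    moreover have "x \<otimes> m \<in> V"
      using xM[OF rm(2)] IV by blast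
    ultimately show ?thesis
      using V'(7) by simp
  qed
  then show "x \<in> I"
    using xA Ac by (auto simp: I colon_def)
qed

text \<open>The witness for the intermediate ring is A + I. Its conductor \<open>C\<close> contains
  \<open>I\<close>; if it were larger, a prime violating \<open>colon\<close> would arise.\<close>

lemma (in cring) colon_subset_imp_conductor_ideal:
  assumes A: "subring A R" and I: "ideal I R"
    and noeth: "noetherian_ring (R Quot I)"
    and pir: "principal_ideal_ring (R\<lparr>carrier := A\<rparr> Quot (I \<inter> A))"
    and colon: "\<And>M. primeideal M R \<Longrightarrow> I \<subseteq> M \<Longrightarrow> A <+>\<^bsub>R\<^esub> M = carrier R \<Longrightarrow> colon R I A M \<subseteq> I"
  shows "conductor_ideal R A I"
proof -
  interpret I: ideal I R by fact
  note A' = subringE[OF A]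
  have Ac: "x \<in> carrier R" if "x \<in> A" for x
    using A'(1) that by blast
  let ?A = "R\<lparr>carrier := A\<rparr>"
  define C where "C = colon R (A <+>\<^bsub>R\<^esub> I) (carrier R) (carrier R)"
  have sub: "subring (A <+>\<^bsub>R\<^esub> I) R"
    using A I by (rule subring_add_ideal)
  interpret C: ideal C R
    unfolding C_def using sub by (rule conductor_is_ideal)
  have AI: "A \<subseteq> A <+>\<^bsub>R\<^esub> I" "I \<subseteq> A <+>\<^bsub>R\<^esub> I"
  proof -
    have "x = x \<oplus> \<zero>" if "x \<in> A" for x
      using that Ac by simp
    then show "A \<subseteq> A <+>\<^bsub>R\<^esub> I"
      unfolding subset_iff mem_set_add_iff using I.zero_closed by blast
    have "i = \<zero> \<oplus> i" if "i \<in> I" for i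
      using that by simp
    then show "I \<subseteq> A <+>\<^bsub>R\<^esub> I"
      unfolding subset_iff mem_set_add_iff using A'(2) by blast
  qed
  have IC: "I \<subseteq> C"
  proof
    fix i assume i: "i \<in> I"
    then have "i \<otimes> s \<in> A <+>\<^bsub>R\<^esub> I" if "s \<in> carrier R" for s
      using AI(2) I.I_r_closed that by blast
    then show "i \<in> C"
      unfolding C_def colon_def using i by simp
  qed
  \<comment> \<open>Modular law: C is contained in A + I and contains \<open>I\<close>, so the
    component r = c - i remains in \<open>C\<close>.\<close>
  have CD: "\<exists>r\<in>C \<inter> A. \<exists>i\<in>I. c = r \<oplus> i" if c: "c \<in> C" for c
  proof -
    have "c \<otimes> \<one> \<in> A <+>\<^bsub>R\<^esub> I"
      using c unfolding C_def colon_def by blast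
    then have "c \<in> A <+>\<^bsub>R\<^esub> I"
      using c by simp
    then obtain r i where ri: "r \<in> A" "i \<in> I" "c = r \<oplus> i"
      unfolding mem_set_add_iff by blast
    have "r = c \<oplus> \<ominus> i"
      using ri Ac by (simp add: a_assoc r_neg)
    moreover have "\<ominus> i \<in> C"
      using IC I.a_inv_closed[OF ri(2)] by blast
    ultimately have "r \<in> C"
      using C.a_closed[OF c] by simp
    with ri show ?thesis by blast
  qed
  interpret A: cring ?A
    using subcringI'[OF A] subcring_iff[OF A'(1)] by simp
  have inter: "ideal (J \<inter> A) ?A" if "ideal J R" for J
  proof -
    interpret J: ideal J R by fact
    show ?thesis
    proof (rule idealI)
      show "ring ?A" by (rule A.ring_axioms)
      have "subgroup (J \<inter> A) (add_monoid R\<lparr>carrier := A\<rparr>)"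
        using subring.axioms(1)[OF A] J.a_subgroup
        by (intro add.subgroup_incl add.subgroups_Inter_pair) auto
      then show "subgroup (J \<inter> A) (add_monoid ?A)" by simp
    qed (auto simp: A' Ac J.I_l_closed J.I_r_closed)
  qed
  have "C \<subseteq> I"
  proof (rule ccontr)
    assume "\<not> C \<subseteq> I"
    \<comment> \<open>The principal ideal hypothesis concerns \<open>A\<close>, so the generator is
      taken in the ring \<open>?A\<close>, for the contractions of \<open>I\<close> and
      \<open>C\<close>.\<close>
    have "\<exists>a\<in>C \<inter> A. \<forall>x\<in>C \<inter> A. \<exists>r\<in>A. \<exists>k\<in>I \<inter> A. x = k \<oplus> r \<otimes> a"
      using A.principal_modulo_ideal[OF inter[OF I] pir inter[OF C.is_ideal]] by simp
    then obtain a where aCA: "a \<in> C \<inter> A"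
      and gen: "\<forall>x\<in>C \<inter> A. \<exists>r\<in>A. \<exists>k\<in>I \<inter> A. x = k \<oplus> r \<otimes> a" ..
    have a: "a \<in> C" using aCA by blast
    then have ac: "a \<in> carrier R" by simp
    \<comment> \<open>Otherwise \<open>gen\<close> would put the contraction of \<open>C\<close>
      into \<open>I\<close>, and \<open>CD\<close> then all of \<open>C\<close>.\<close>
    have "a \<notin> I"
    proof
      assume "a \<in> I"
      have "c \<in> I" if c: "c \<in> C" for c
      proof -
        obtain r i where ri: "r \<in> C \<inter> A" "i \<in> I" "c = r \<oplus> i" using CD[OF c] by blast
        then obtain t k where "t \<in> A" "k \<in> I" "r = k \<oplus> t \<otimes> a" using bspec[OF gen] by blast
        then have "r \<in> I" using \<open>a \<in> I\<close> by (simp add: Ac I.I_l_closed)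
        then show ?thesis using ri by simp
      qed
      with \<open>\<not> C \<subseteq> I\<close> show False by blast
    qed
    then obtain b where b: "b \<in> carrier R" "a \<otimes> b \<notin> I"
      and prime: "primeideal (colon R I (carrier R) {a \<otimes> b}) R"
      using exists_prime_colon[OF I noeth ac] by blast
    define M where "M = colon R I (carrier R) {a \<otimes> b}"
    have "I \<subseteq> M"
      using ac b by (auto simp: M_def colon_def I.I_r_closed)
    \<comment> \<open>Modulo \<open>I\<close>, the element \<open>as\<close> of \<open>C\<close>
      equals some \<open>ta\<close> with \<open>t\<close> in \<open>A\<close>. Thus (s - t)a is in
      \<open>I\<close>, which places s - t in \<open>M\<close>.\<close>
    have "s \<in> A <+>\<^bsub>R\<^esub> M" if s: "s \<in> carrier R" for s
    proof -
      have as: "a \<otimes> s \<in> C" using a s by (simp add: C.I_r_closed)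
      then obtain r i where ri: "r \<in> C \<inter> A" "i \<in> I" "a \<otimes> s = r \<oplus> i" using CD[OF as] by blast
      then obtain t k where tk: "t \<in> A" "k \<in> I" "r = k \<oplus> t \<otimes> a" using bspec[OF gen] by blast
      note c = ac s b(1) Ac[OF tk(1)] I.Icarr[OF tk(2)] I.Icarr[OF ri(2)]
      have "(s \<ominus> t) \<otimes> a = a \<otimes> s \<ominus> t \<otimes> a" using c by algebra
      also have "\<dots> = k \<oplus> i" unfolding ri(3) tk(3) using c by algebra
      finally have "(s \<ominus> t) \<otimes> a \<otimes> b \<in> I"
        using ri(2) tk(2) c by (simp add: I.I_r_closed)
      then have "s \<ominus> t \<in> M" using c by (simp add: M_def colon_def m_assoc)
      moreover have "s = t \<oplus> (s \<ominus> t)" using c by algebra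
      ultimately show ?thesis using tk(1) by (auto simp: mem_set_add_iff)
    qed
    moreover have "A <+>\<^bsub>R\<^esub> M \<subseteq> carrier R"
      using Ac by (auto simp: mem_set_add_iff M_def colon_def)
    ultimately have "A <+>\<^bsub>R\<^esub> M = carrier R" by blast
    then have sub: "colon R I A M \<subseteq> I"
      using colon prime \<open>I \<subseteq> M\<close> by (simp add: M_def)
    \<comment> \<open>The product \<open>ab\<close> kills \<open>M\<close> modulo \<open>I\<close>
      but need not lie in \<open>A\<close>; its component \<open>r\<close> in \<open>A\<close> is
      congruent to it modulo \<open>I\<close> and therefore also kills \<open>M\<close>.\<close>
    have ab: "a \<otimes> b \<in> C" using a b by (simp add: C.I_r_closed)
    then obtain r i where ri: "r \<in> A" "i \<in> I" "a \<otimes> b = r \<oplus> i" using CD[OF ab] by blast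
    have "r \<otimes> m \<in> I" if m: "m \<in> M" for m
    proof -
      have mc: "m \<in> carrier R" "m \<otimes> (a \<otimes> b) \<in> I"
        using m by (auto simp: M_def colon_def)
      note c = mc(1) Ac[OF ri(1)] I.Icarr[OF ri(2)]
      have "r \<otimes> m = m \<otimes> (r \<oplus> i) \<oplus> m \<otimes> (\<ominus> i)" using c by algebra
      then show ?thesis
        using mc ri by (simp add: I.I_l_closed del: r_minus)
    qed
    then have "r \<in> I" using sub ri(1) by (auto simp: colon_def)
    then show False using b ri by simp
  qed
  then have "I = C" using IC by blast
  then show ?thesis
    unfolding conductor_ideal_def C_def using I sub AI(1) by blast
qed

theorem theorem2p7:
  fixes S :: "('a, 'b) ring_scheme" and R I :: "'a set"
  assumes "cring S"
    and "subring R S"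
    and "ideal I S"
    and "noetherian_ring (S Quot I)"
    and "principal_ideal_ring ((S\<lparr>carrier := R\<rparr>) Quot (I \<inter> R))"
  shows "conductor_ideal S R I \<longleftrightarrow>
    (\<forall>M \<in> prime_ideals_above S I.
       R <+>\<^bsub>S\<^esub> M \<subset> carrier S \<or> colon S I R M \<subseteq> I)"
proof
  interpret cring S by fact
  assume cond: "conductor_ideal S R I"
  show "\<forall>M \<in> prime_ideals_above S I. R <+>\<^bsub>S\<^esub> M \<subset> carrier S \<or> colon S I R M \<subseteq> I"
  proof
    fix M assume "M \<in> prime_ideals_above S I"
    then interpret M: primeideal M S by (simp add: prime_ideals_above_def)
    have M: "M \<subseteq> carrier S" by (rule M.a_subset)
    \<comment> \<open>With this inclusion, failure of strictness means R + M = S.\<close>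
    then have "R <+>\<^bsub>S\<^esub> M \<subseteq> carrier S"
      using subringE(1)[OF assms(2)] by (intro set_add_closed)
    then show "R <+>\<^bsub>S\<^esub> M \<subset> carrier S \<or> colon S I R M \<subseteq> I"
      using conductor_ideal_imp_colon_subset[OF cond M] by blast
  qed
next
  interpret cring S by fact
  assume "\<forall>M \<in> prime_ideals_above S I. R <+>\<^bsub>S\<^esub> M \<subset> carrier S \<or> colon S I R M \<subseteq> I"
  then show "conductor_ideal S R I"
    by (intro colon_subset_imp_conductor_ideal assms(2-5)) (auto simp: prime_ideals_above_def)
qed

end
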